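(* Let $\eta_D(s)=\sum_{n\ge 1}a_ne^{-\lambda_n s}$ be the Dirichlet dynamical zeta function of the billiard flow outside $D=\bigcup_{j=1}^r D_j$, with abscissa of convergence $\sigma_c<0$, and let $\delta>h+2$. Assume that there exist constants $c_1>0$, $c_2>0$ and $n_0\in\mathbb{N}$ such that $|a_n|\ge c_1e^{-c_2\lambda_n}$ for all $n\ge n_0$, and let $\gamma>c_2+1$. Then for every clustering interval $I(\lambda_k,\delta)=[\lambda_{k-p},\lambda_{k+q}]\subset(b,b+1)$ with $b$ sufficiently large, exactly one of (i), (ii) and exactly one of (iii), (iv) holds, where $$\text{(i)}\ \Bigl|\sum_{n\ge k-p}a_n\Bigr|\ge e^{-\gamma\lambda_{k-p}},\qquad \text{(ii)}\ \Bigl|\sum_{n\ge k-p}a_n\Bigr|<e^{-\gamma\lambda_{k-p}},$$ $$\text{(iii)}\ \Bigl|\sum_{n\ge k+q}a_n\Bigr|\ge e^{-\gamma\lambda_{k+q}},\qquad \text{(iv)}\ \Bigl|\sum_{n\ge k+q}a_n\Bigr|<e^{-\gamma\lambda_{k+q}},$$ so that there are four possibilities (i)-(iii), (i)-(iv), (ii)-(iii), (ii)-(iv). If (i) holds, or if (ii) and (iv) both hold, then for at least one of the indices $m=k-p$ or $m=k+q+1$ (that is, for the interval $[\lambda_{k-p-1},\lambda_{k-p}]$ or the interval $[\lambda_{k+q},\lambda_{k+q+1}]$) one has $$\lambda_m-\lambda_{m-1}\ge Ce^{-\delta\lambda_m}\qquad\text{and}\qquad \Bigl|\sum_{n\ge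 m}a_n\Bigr|\ge e^{-\gamma\lambda_m},$$ with a constant $C>0$ independent of the interval.
   Context: Setting. $D_1,\dots,D_r\subset\mathbb{R}^d$, $r\ge 3$, $d\ge 2$, are pairwise disjoint compact strictly convex sets with non-empty interior and $C^\infty$ boundary, $D=\bigcup_{j=1}^rD_j$, satisfying the non-eclipse condition: $D_k\cap\text{convex hull}(D_i\cup D_j)=\emptyset$ for all $1\le i,j,k\le r$ with $i\ne k$, $j\ne k$. Consider the (non-grazing) billiard flow in $\mathbb{R}^d\setminus\mathring{D}$ (unit speed straight motion, with the usual law of reflection at $\partial D$). Under the non-eclipse condition all periodic billiard trajectories are ordinary reflecting, without tangential contact with $\partial D$. Periodic trajectories are called periodic rays. $\mathcal{P}$ is the set of all oriented periodic rays (including repetitions of primitive ones) and $\Pi\subset\mathcal{P}$ the set of primitive ones. For $\mathfrak{g}\in\mathcal{P}$, $\tau(\mathfrak{g})>0$ is its period (length), $\tau^\sharp(\mathfrak{g})>0$ its primitive period, $m(\mathfrak{g})$ the number of its reflections at the obstacles, and $P_{\mathfrak{g}}$ its linearized Poincaré map. The number $h>0$ is the constant for which $\sharp\{\mathfrak{g}\in\Pi:\tau^\sharp(\mathfrak{g})\le x\}\sim \frac{e^{hx}}{hx}$ as $x\to+\infty$; moreover for every small $\epsilon>0$, $e^{(h-\epsilon)x}\le\sharp\{\mathfrak{g}\in\mathcal{P}:\tau(\mathfrak{g})\le x\}\le e^{(h+\epsilon)x}$ for $x>C_\epsilon$. It is known that for some $C_1,d_1,d_2>0$ one has $C_1e^{d_1\tau(\mathfrak{g})}\le|\det(\mathrm{Id}-P_{\mathfrak{g}})|\le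 e^{d_2\tau(\mathfrak{g})}$ for all $\mathfrak{g}\in\mathcal{P}$. The Dirichlet dynamical zeta function is, for $\mathrm{Re}\,s\gg1$, $$\eta_D(s)=\sum_{\mathfrak{g}\in\mathcal{P}}(-1)^{m(\mathfrak{g})}\frac{\tau^\sharp(\mathfrak{g})e^{-s\tau(\mathfrak{g})}}{|\det(\mathrm{Id}-P_{\mathfrak{g}})|^{1/2}}=\sum_{n=1}^\infty a_ne^{-\lambda_ns},$$ where $0<\lambda_1<\lambda_2<\cdots$ are the distinct periods (called frequencies) and $a_n=\sum_{\mathfrak{g}\in\mathcal{P},\,\tau(\mathfrak{g})=\lambda_n}\frac{(-1)^{m(\mathfrak{g})}\tau^\sharp(\mathfrak{g})}{|\det(\mathrm{Id}-P_{\mathfrak{g}})|^{1/2}}$. $\sigma_c$ denotes the abscissa of convergence of $\sum a_ne^{-\lambda_ns}$; if $\sigma_c<0$, the tails $\sum_{n\ge m}a_n$ converge. Clustering intervals. Fix $\delta>h+2$, a small $0<\epsilon\ll1/2$, and a sufficiently large $b_0(\epsilon)$ (in particular $e^{-b}<\epsilon$ and $e^{(h-\delta+\epsilon)b+(h+\epsilon)}<e^{-b}$ for $b\ge b_0(\epsilon)$). Let $b\ge b_0(\epsilon)$ and let $\lambda_k\in[b+e^{-b},b+1-e^{-b}]$ be a frequency. Let $q\ge0$ be the smallest integer with $\lambda_{k+q+1}\notin(\lambda_{k+q},\lambda_{k+q}+e^{-\delta b})$ and $p\ge0$ the smallest integer with $\lambda_{k-p-1}\notin(\lambda_{k-p}-e^{-\delta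 b},\lambda_{k-p})$. Put $I(\lambda_k,\delta)=[\lambda_{k-p},\lambda_{k+q}]$ (possibly the single point $\{\lambda_k\}$). Then $I(\lambda_k,\delta)\subset(b,b+1)$. *)

theory Defs
  imports "HOL-Analysis.Analysis" "HOL-Library.Landau_Symbols"
begin

section \<open>Obstacles\<close>

primrec C_k_on :: "nat \<Rightarrow> ('a::euclidean_space \<Rightarrow> real) \<Rightarrow> 'a set \<Rightarrow> bool" where
  "C_k_on 0 f U \<longleftrightarrow> continuous_on U f"
| "C_k_on (Suc k) f U \<longleftrightarrow> (\<forall>x\<in>U. f differentiable (at x)) \<and>
     (\<forall>b\<in>Basis. C_k_on k (\<lambda>x. frechet_derivative f (at x) b) U)"

definition smooth_on :: "('a::euclidean_space \<Rightarrow> real) \<Rightarrow> 'a set \<Rightarrow> bool" where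
  "smooth_on f U \<longleftrightarrow> (\<forall>k. C_k_on k f U)"

definition defining_function :: "'a::euclidean_space set \<Rightarrow> 'a set \<Rightarrow> ('a \<Rightarrow> real) \<Rightarrow> bool" where
  "defining_function A U \<rho> \<longleftrightarrow> open U \<and> smooth_on \<rho> U \<and>
     (\<forall>y\<in>U. \<not> (GDERIV \<rho> y :> 0)) \<and> A \<inter> U = {y\<in>U. \<rho> y \<le> 0}"

definition smooth_boundary :: "'a::euclidean_space set \<Rightarrow> bool" where
  "smooth_boundary A \<longleftrightarrow> (\<forall>x\<in>frontier A. \<exists>U \<rho>. x \<in> U \<and> defining_function A U \<rho>)"

definition outer_normal :: "'a::euclidean_space set \<Rightarrow> 'a \<Rightarrow> 'a" where
  "outer_normal A x =
     (THE n. \<exists>U \<rho> g. x \<in> U \<and> defining_function A U \<rho> \<and> (GDERIV \<rho> x :> g) \<and> n = sgn g)"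

definition strictly_convex :: "'a::euclidean_space set \<Rightarrow> bool" where
  "strictly_convex K \<longleftrightarrow> (\<forall>x\<in>K. \<forall>y\<in>K. x \<noteq> y \<longrightarrow> open_segment x y \<subseteq> interior K)"

definition non_eclipse :: "nat \<Rightarrow> (nat \<Rightarrow> 'a::euclidean_space set) \<Rightarrow> bool" where
  "non_eclipse r D \<longleftrightarrow> (\<forall>i\<in>{1..r}. \<forall>j\<in>{1..r}. \<forall>k\<in>{1..r}. i \<noteq> k \<and> j \<noteq> k \<longrightarrow>
     D k \<inter> convex hull (D i \<union> D j) = {})"

definition obstacles :: "nat \<Rightarrow> (nat \<Rightarrow> 'a::euclidean_space set) \<Rightarrow> bool" where
  "obstacles r D \<longleftrightarrow>
     (\<forall>j\<in>{1..r}. compact (D j) \<and> strictly_convex (D j) \<and> interior (D j) \<noteq> {} \<and>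
        smooth_boundary (D j)) \<and>
     disjoint_family_on D {1..r} \<and> non_eclipse r D"


section \<open>Billiard flow\<close>

text \<open>
  From here on \<open>A\<close> is the union of the obstacles.  Points of phase space are pairs (position,
  velocity).  At a reflection time the velocity of a trajectory is the outgoing one, and \<open>w\<close>
  below is the incoming one; tangential contact with \<open>A\<close> is excluded (non-grazing flow).
  If \<open>J\<close> has a first element \<open>t\<close>, the last conjunct at \<open>t\<close> only says that the velocity
  is outgoing when the initial position lies on the boundary.
\<close>

definition reflect :: "'a::real_inner \<Rightarrow> 'a \<Rightarrow> 'a" where
  "reflect n w = w - (2 * (w \<bullet> n)) *\<^sub>R n"

definition billiard_trajectory ::
    "'a::euclidean_space set \<Rightarrow> real set \<Rightarrow> (real \<Rightarrow> 'a \<times> 'a) \<Rightarrow> bool" where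
  "billiard_trajectory A J c \<longleftrightarrow> (\<forall>t\<in>J. case c t of (x, v) \<Rightarrow>
     x \<notin> interior A \<and> norm v = 1 \<and>
     (\<exists>e>0. \<forall>s\<in>{0..e}. t + s \<in> J \<longrightarrow> c (t + s) = (x + s *\<^sub>R v, v)) \<and>
     (\<exists>e>0. \<exists>w. (\<forall>s\<in>{0<..e}. t - s \<in> J \<longrightarrow> c (t - s) = (x - s *\<^sub>R w, w)) \<and>
        (if x \<in> A then w \<bullet> outer_normal A x < 0 \<and> v = reflect (outer_normal A x) w
         else v = w)))"

definition billiard_flow ::
    "'a::euclidean_space set \<Rightarrow> real \<Rightarrow> 'a \<times> 'a \<Rightarrow> 'a \<times> 'a" where
  "billiard_flow A t z = (THE z'. \<exists>c. billiard_trajectory A {0..t} c \<and> c 0 = z \<and> c t = z')"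


section \<open>Periodic rays\<close>

text \<open>
  An oriented periodic ray, possibly a repetition of a primitive one, is encoded as a pair
  \<open>(\<Gamma>, T)\<close>: \<open>\<Gamma>\<close> is a periodic orbit in phase space (which carries the orientation) and
  \<open>T > 0\<close> is one of its periods.
\<close>

definition periodic_rays :: "'a::euclidean_space set \<Rightarrow> (('a \<times> 'a) set \<times> real) set" where
  "periodic_rays A = {(\<Gamma>, T). T > 0 \<and>
     (\<exists>c. billiard_trajectory A UNIV c \<and> (\<forall>t. c (t + T) = c t) \<and> \<Gamma> = range c)}"

definition period :: "('a \<times> 'a) set \<times> real \<Rightarrow> real" where
  "period g = snd g"

definition primitive_rays :: "'a::euclidean_space set \<Rightarrow> (('a \<times> 'a) set \<times> real) set" where
  "primitive_rays A =
     {g \<in> periodic_rays A. \<forall>g'\<in>periodic_rays A. fst g' = fst g \<longrightarrow> period g \<le> period g'}"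

definition primitive_period ::
    "'a::euclidean_space set \<Rightarrow> ('a \<times> 'a) set \<times> real \<Rightarrow> real" where
  "primitive_period A g = (THE T. (fst g, T) \<in> primitive_rays A)"

definition reflection_number ::
    "'a::euclidean_space set \<Rightarrow> ('a \<times> 'a) set \<times> real \<Rightarrow> nat" where
  "reflection_number A g =
     (let c = (SOME c. billiard_trajectory A UNIV c \<and> range c = fst g)
      in card {t \<in> {0..<period g}. fst (c t) \<in> A})"


section \<open>Linearized Poincare map\<close>

text \<open>Determinant of (the compression to \<open>V\<close> of) \<open>f\<close>, by the Leibniz formula in an orthonormal
  basis of the subspace \<open>V\<close>; it does not depend on the basis.\<close>

definition subspace_det :: "'b::euclidean_space set \<Rightarrow> ('b \<Rightarrow> 'b) \<Rightarrow> real" where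
  "subspace_det V f =
     (let B = (SOME B. B \<subseteq> V \<and> pairwise orthogonal B \<and> (\<forall>b\<in>B. norm b = 1) \<and> span B = V)
      in \<Sum>p | p permutes B. of_int (sign p) * (\<Prod>b\<in>B. f b \<bullet> p b))"

text \<open>
  The tangent space of the unit sphere bundle at \<open>(x, v)\<close> is \<open>{(y, w). w \<bullet> v = 0}\<close>, and the flow
  direction at a non-boundary point is \<open>(v, 0)\<close>.  The transversal space below is the kernel of the
  contact form, i.e. the sum of the stable and unstable spaces, and is the tangent space of the
  Poincare section orthogonal to the ray.  It is preserved by the differential of the flow over a
  period, and the restriction of that differential is the linearized Poincare map.
\<close>

definition transversal_space :: "'a::euclidean_space \<times> 'a \<Rightarrow> ('a \<times> 'a) set" where
  "transversal_space z = {(y, w). y \<bullet> snd z = 0 \<and> w \<bullet> snd z = 0}"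

text \<open>The flow lives on unit velocities; composing with \<open>sgn w = w / norm w\<close> extends it to a
  neighbourhood, without changing its derivative in directions tangent to the sphere bundle.\<close>

definition poincare_map ::
    "'a::euclidean_space set \<Rightarrow> real \<Rightarrow> 'a \<times> 'a \<Rightarrow> 'a \<times> 'a \<Rightarrow> 'a \<times> 'a" where
  "poincare_map A T z =
     frechet_derivative (\<lambda>(y, w). billiard_flow A T (y, sgn w)) (at z)"

text \<open>Up to conjugacy the Poincare map does not depend on the base point \<open>z\<close> on the ray, which is
  taken off the boundary.\<close>

definition det_id_minus_poincare ::
    "'a::euclidean_space set \<Rightarrow> ('a \<times> 'a) set \<times> real \<Rightarrow> real" where
  "det_id_minus_poincare A g =
     (let z = (SOME z. z \<in> fst g \<and> fst z \<notin> A)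
      in subspace_det (transversal_space z) (\<lambda>u. u - poincare_map A (period g) z u))"


section \<open>The Dirichlet dynamical zeta function\<close>

definition frequencies :: "'a::euclidean_space set \<Rightarrow> real set" where
  "frequencies A = period ` periodic_rays A"

text \<open>\<open>frequency A n\<close> is the \<open>n\<close>-th smallest frequency, for \<open>n \<ge> 1\<close>; the value at \<open>n = 0\<close> is
  meaningless and likewise for the coefficients.\<close>

definition frequency :: "'a::euclidean_space set \<Rightarrow> nat \<Rightarrow> real" where
  "frequency A n = (THE l. l \<in> frequencies A \<and> card {l' \<in> frequencies A. l' \<le> l} = n)"

definition eta_coeff :: "'a::euclidean_space set \<Rightarrow> nat \<Rightarrow> real" where
  "eta_coeff A n = (\<Sum>g | g \<in> periodic_rays A \<and> period g = frequency A n.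
     (-1) ^ reflection_number A g * primitive_period A g / sqrt \<bar>det_id_minus_poincare A g\<bar>)"

definition eta_term :: "'a::euclidean_space set \<Rightarrow> complex \<Rightarrow> nat \<Rightarrow> complex" where
  "eta_term A s n = of_real (eta_coeff A n) * exp (- (of_real (frequency A n) * s))"

definition eta_abscissa :: "'a::euclidean_space set \<Rightarrow> ereal" where
  "eta_abscissa A = Inf {ereal (Re s) |s. summable (\<lambda>n. eta_term A s (Suc n))}"

definition eta_tail :: "'a::euclidean_space set \<Rightarrow> nat \<Rightarrow> real" where
  "eta_tail A m = (\<Sum>n. eta_coeff A (m + n))"


section \<open>Clustering intervals\<close>

definition cluster_right :: "(nat \<Rightarrow> real) \<Rightarrow> real \<Rightarrow> real \<Rightarrow> nat \<Rightarrow> nat" where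
  "cluster_right lam \<delta> b k =
     (LEAST q. lam (k + q + 1) \<notin> {lam (k + q)<..<lam (k + q) + exp (- \<delta> * b)})"

text \<open>The disjunct \<open>k \<le> p + 1\<close> stops at the first frequency, which has no predecessor.\<close>

definition cluster_left :: "(nat \<Rightarrow> real) \<Rightarrow> real \<Rightarrow> real \<Rightarrow> nat \<Rightarrow> nat" where
  "cluster_left lam \<delta> b k =
     (LEAST p. k \<le> p + 1 \<or>
        lam (k - p - 1) \<notin> {lam (k - p) - exp (- \<delta> * b)<..<lam (k - p)})"

end

theory Submission
  imports Defs "HOL-Real_Asymp.Real_Asymp"
begin

text \<open>
  The two sides of a clustering interval carry gaps of length at least \<open>exp (-\<delta> b)\<close>
  by maximality of the cluster, so only the size of the tails matters.
  Under (i) the left gap works. Under (iv) the term \<open>a\<^sub>k\<^sub>+\<^sub>q\<close> is much larger than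
  the tail starting at it, so the tail starting one index later is large and the right gap works.
  The cluster stays inside \<open>(b, b+1)\<close> because the asymptotics for the primitive rays bound the
  number of frequencies below \<open>b+1\<close> by a constant times \<open>exp (h b)\<close>, which is
  negligible against \<open>exp ((\<delta>-1) b)\<close>. To pass from primitive rays to frequencies one needs that
  every ray repeats a primitive one, which follows from forward uniqueness of billiard trajectories.
\<close>

section \<open>Periodic rays are repetitions of primitive ones\<close>

lemma billiard_trajectory_shift:
  assumes "billiard_trajectory A UNIV c"
  shows "billiard_trajectory A UNIV (\<lambda>t. c (a + t))"
  unfolding billiard_trajectory_def
proof
  fix t :: real
  show "case c (a + t) of (x, v) \<Rightarrow> x \<notin> interior A \<and> norm v = 1 \<and>
     (\<exists>e>0. \<forall>s\<in>{0..e}. t + s \<in> UNIV \<longrightarrow> c (a + (t + s)) = (x + s *\<^sub>R v, v)) \<and>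
     (\<exists>e>0. \<exists>w. (\<forall>s\<in>{0<..e}. t - s \<in> UNIV \<longrightarrow> c (a + (t - s)) = (x - s *\<^sub>R w, w)) \<and>
        (if x \<in> A then w \<bullet> outer_normal A x < 0 \<and> v = reflect (outer_normal A x) w
         else v = w))"
    using assms[unfolded billiard_trajectory_def, rule_format, of "a + t"]
    by (simp add: add.assoc add_diff_eq)
qed

lemma billiard_trajectory_forward:
  assumes "billiard_trajectory A UNIV c"
  obtains e where "e > 0" "norm (snd (c t)) = 1"
    "\<And>s. 0 \<le> s \<Longrightarrow> s \<le> e \<Longrightarrow> c (t + s) = (fst (c t) + s *\<^sub>R snd (c t), snd (c t))"
proof -
  have "norm (snd (c t)) = 1 \<and>
    (\<exists>e>0. \<forall>s\<in>{0..e}. c (t + s) = (fst (c t) + s *\<^sub>R snd (c t), snd (c t)))"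
    using assms[unfolded billiard_trajectory_def, rule_format, of t]
    by (simp add: case_prod_unfold)
  then show ?thesis
    using that by auto
qed

lemma billiard_trajectory_backward:
  assumes "billiard_trajectory A UNIV c"
  obtains e w where "e > 0" "\<And>s. 0 < s \<Longrightarrow> s \<le> e \<Longrightarrow> c (t - s) = (fst (c t) - s *\<^sub>R w, w)"
    "snd (c t) = (if fst (c t) \<in> A then reflect (outer_normal A (fst (c t))) w else w)"
proof -
  have "\<exists>e>0. \<exists>w. (\<forall>s\<in>{0<..e}. c (t - s) = (fst (c t) - s *\<^sub>R w, w)) \<and>
    snd (c t) = (if fst (c t) \<in> A then reflect (outer_normal A (fst (c t))) w else w)"
    using assms[unfolded billiard_trajectory_def, rule_format, of t]
    by (auto simp: case_prod_unfold split: if_splits)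
  then show ?thesis
    using that by auto
qed

lemma billiard_trajectory_unique:
  assumes c: "billiard_trajectory A UNIV c" and c': "billiard_trajectory A UNIV c'"
    and init: "c 0 = c' 0" and "t \<ge> 0"
  shows "c t = c' t"
proof (rule ccontr)
  assume "c t \<noteq> c' t"
  define B where "B = {s. 0 \<le> s \<and> c s \<noteq> c' s}"
  have ne: "B \<noteq> {}" and bdd: "bdd_below B"
    using \<open>c t \<noteq> c' t\<close> \<open>t \<ge> 0\<close> by (auto simp: B_def bdd_below_def)
  define u where "u = Inf B"
  have "u \<ge> 0"
    unfolding u_def using ne by (intro cInf_greatest) (auto simp: B_def)
  have before: "c s = c' s" if "0 \<le> s" "s < u" for s
    using that cInf_lower[OF _ bdd, of s] by (fastforce simp: u_def B_def)
  have at: "c u = c' u"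
  proof (cases "u = 0")
    case False
    with \<open>u \<ge> 0\<close> have "u > 0" by simp
    obtain e w where e: "e > 0" "\<And>s. 0 < s \<Longrightarrow> s \<le> e \<Longrightarrow> c (u - s) = (fst (c u) - s *\<^sub>R w, w)"
      "snd (c u) = (if fst (c u) \<in> A then reflect (outer_normal A (fst (c u))) w else w)"
      using billiard_trajectory_backward[OF c] by metis
    obtain e' w' where e': "e' > 0"
      "\<And>s. 0 < s \<Longrightarrow> s \<le> e' \<Longrightarrow> c' (u - s) = (fst (c' u) - s *\<^sub>R w', w')"
      "snd (c' u) = (if fst (c' u) \<in> A then reflect (outer_normal A (fst (c' u))) w' else w')"
      using billiard_trajectory_backward[OF c'] by metis
    define s where "s = min (min e e') u"
    have "s > 0" "s \<le> e" "s \<le> e'" "s \<le> u"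
      using e(1) e'(1) \<open>u > 0\<close> by (auto simp: s_def)
    then have "c (u - s) = c' (u - s)"
      by (intro before) auto
    then have "w = w'" "fst (c u) = fst (c' u)"
      using e(2)[of s] e'(2)[of s] \<open>s > 0\<close> \<open>s \<le> e\<close> \<open>s \<le> e'\<close> by auto
    with e(3) e'(3) show ?thesis
      by (simp add: prod_eq_iff)
  qed (use init in simp)
  obtain e where e: "e > 0"
    "\<And>s. 0 \<le> s \<Longrightarrow> s \<le> e \<Longrightarrow> c (u + s) = (fst (c u) + s *\<^sub>R snd (c u), snd (c u))"
    using billiard_trajectory_forward[OF c] by metis
  obtain e' where e': "e' > 0"
    "\<And>s. 0 \<le> s \<Longrightarrow> s \<le> e' \<Longrightarrow> c' (u + s) = (fst (c' u) + s *\<^sub>R snd (c' u), snd (c' u))"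
    using billiard_trajectory_forward[OF c'] by metis
  obtain s where s: "s \<in> B" "s < u + min e e'"
    using cInf_lessD[OF ne, of "u + min e e'"] e(1) e'(1) by (auto simp: u_def)
  have "s \<ge> u"
    using cInf_lower[OF s(1) bdd] by (simp add: u_def)
  then have "c s = c' s"
    using e(2)[of "s - u"] e'(2)[of "s - u"] s(2) at by simp
  with s(1) show False by (simp add: B_def)
qed

lemma period_of_same_range:
  assumes c: "billiard_trajectory A UNIV c" and "T > 0" and T: "\<And>t. c (t + T) = c t"
    and ray: "(range c, T') \<in> periodic_rays A"
  shows "c (t + T') = c t"
proof -
  obtain c' where c': "billiard_trajectory A UNIV c'" "\<And>t. c' (t + T') = c' t"
    "range c = range c'" "T' > 0"
    using ray by (auto simp: periodic_rays_def)
  obtain a where "c' 0 = c a"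
    by (metis c'(3) rangeE rangeI)
  then have eq: "c' s = c (a + s)" if "s \<ge> 0" for s
    using billiard_trajectory_unique[OF c'(1) billiard_trajectory_shift[OF c, of a]] that by simp
  have nT: "c (t + real n * T) = c t" for n t
  proof (induction n)
    case (Suc n)
    have "c (t + real (Suc n) * T) = c (t + real n * T + T)"
      by (simp add: algebra_simps)
    with Suc T show ?case by simp
  qed simp
  obtain n where n: "real n * T > a - t"
    using reals_Archimedean3[OF \<open>T > 0\<close>] by blast
  define s where "s = t + real n * T - a"
  have "s \<ge> 0" using n by (simp add: s_def)
  have "c (t + T') = c (a + (s + T'))"
    using nT[of "t + T'" n] by (simp add: s_def algebra_simps)
  also have "\<dots> = c' (s + T')"
    using eq[of "s + T'"] \<open>s \<ge> 0\<close> \<open>T' > 0\<close> by simp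
  also have "\<dots> = c (a + s)"
    using c'(2) eq \<open>s \<ge> 0\<close> by simp
  also have "\<dots> = c t"
    using nT[of t n] by (simp add: s_def)
  finally show ?thesis .
qed

lemma periodic_ray_multiple:
  assumes "(\<Gamma>, T) \<in> periodic_rays A"
  obtains T0 n where "(\<Gamma>, T0) \<in> primitive_rays A" "n \<ge> 1" "T = real n * T0"
proof -
  obtain c where c: "billiard_trajectory A UNIV c" "\<And>t. c (t + T) = c t" "\<Gamma> = range c" "T > 0"
    using assms by (auto simp: periodic_rays_def)
  define Per where "Per = {S. S > 0 \<and> (\<forall>t. c (t + S) = c t)}"
  have T_Per: "T \<in> Per"
    using c by (simp add: Per_def)
  have ray_iff: "(\<Gamma>, S) \<in> periodic_rays A \<longleftrightarrow> S \<in> Per" for S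
  proof
    assume "(\<Gamma>, S) \<in> periodic_rays A"
    moreover from this have "S > 0" by (simp add: periodic_rays_def)
    ultimately show "S \<in> Per"
      using period_of_same_range[OF c(1,4,2)] c(3) by (simp add: Per_def)
  qed (use c in \<open>auto simp: Per_def periodic_rays_def\<close>)
  have diff: "S - S' \<in> Per" if "S \<in> Per" "\<And>t. c (t + S') = c t" "S' < S" for S S'
  proof -
    have "c (t + (S - S')) = c t" for t
      using that(2)[of "t + (S - S')"] that(1) by (simp add: Per_def)
    then show ?thesis using that(3) by (simp add: Per_def)
  qed
  obtain e where e: "e > 0" "norm (snd (c 0)) = 1"
    "\<And>s. 0 \<le> s \<Longrightarrow> s \<le> e \<Longrightarrow> c (0 + s) = (fst (c 0) + s *\<^sub>R snd (c 0), snd (c 0))"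
    using billiard_trajectory_forward[OF c(1)] by metis
  have Per_gt: "S > e" if "S \<in> Per" for S
  proof (rule ccontr)
    assume "\<not> S > e"
    moreover have "S > 0" "c (0 + S) = c 0"
      using that unfolding Per_def by blast+
    ultimately have "fst (c 0) = fst (c 0) + S *\<^sub>R snd (c 0)"
      using e(3)[of S] by (metis fst_conv less_imp_le not_less)
    with \<open>S > 0\<close> have "snd (c 0) = 0" by simp
    with e(2) show False by simp
  qed
  have bdd: "bdd_below Per"
    by (auto simp: Per_def bdd_below_def intro: exI[of _ 0] less_imp_le)
  obtain T0 where T0: "T0 \<in> Per" "T0 < Inf Per + e"
    using cInf_lessD[of Per "Inf Per + e"] T_Per e(1) by auto
  have min: "T0 \<le> S" if "S \<in> Per" for S
  proof (rule ccontr)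
    assume "\<not> T0 \<le> S"
    then have "T0 - S \<in> Per"
      using diff[OF T0(1), of S] that by (simp add: Per_def)
    from Per_gt[OF this] cInf_lower[OF that bdd] T0(2) show False by simp
  qed
  have nT0: "c (t + real n * T0) = c t" for n t
  proof (induction n)
    case (Suc n)
    have "c (t + real (Suc n) * T0) = c (t + real n * T0 + T0)"
      by (simp add: algebra_simps)
    with Suc T0(1) show ?case by (simp add: Per_def)
  qed simp
  have "T0 > 0" using T0(1) by (simp add: Per_def)
  define n where "n = nat \<lfloor>T / T0\<rfloor>"
  have "T / T0 \<ge> 1"
    using min[OF T_Per] \<open>T0 > 0\<close> by simp
  then have "n \<ge> 1" and n: "real n \<le> T / T0" "T / T0 < real n + 1"
    unfolding n_def by linarith+
  have le: "real n * T0 \<le> T" and lt: "T < (real n + 1) * T0"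
    using n \<open>T0 > 0\<close> by (simp_all add: field_simps)
  have "T = real n * T0"
  proof (rule ccontr)
    assume "T \<noteq> real n * T0"
    with le have "T - real n * T0 \<in> Per"
      using diff[OF T_Per nT0] by simp
    from min[OF this] lt show False by (simp add: algebra_simps)
  qed
  moreover have "(\<Gamma>, T0) \<in> primitive_rays A"
    using T0(1) min ray_iff by (auto simp: primitive_rays_def period_def)
  ultimately show ?thesis using that \<open>n \<ge> 1\<close> by blast
qed

lemma primitive_period_primitive:
  assumes "g \<in> primitive_rays A"
  shows "primitive_period A g = period g"
  unfolding primitive_period_def
proof (rule the_equality)
  show "(fst g, period g) \<in> primitive_rays A"
    using assms by (simp add: period_def)
  fix T assume T: "(fst g, T) \<in> primitive_rays A"
  have min: "snd g1 \<le> snd g2"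
    if "g1 \<in> primitive_rays A" "g2 \<in> primitive_rays A" "fst g2 = fst g1" for g1 g2
    using that by (simp add: primitive_rays_def period_def)
  show "T = period g"
    using min[OF T assms] min[OF assms T] by (simp add: period_def)
qed


section \<open>Counting frequencies\<close>

lemma frequencies_growth:
  assumes "h > 0"
    and asymp: "(\<lambda>x. real (card {g \<in> primitive_rays A. primitive_period A g \<le> x}))
           \<sim>[at_top] (\<lambda>x. exp (h * x) / (h * x))"
  shows finite_frequencies: "finite {l \<in> frequencies A. l \<le> x}"
    and frequencies_unbounded: "\<exists>l\<in>frequencies A. x < l"
    and card_frequencies_le: "\<exists>K>0. \<forall>\<^sub>F x in at_top.
      real (card {l \<in> frequencies A. l \<le> x}) \<le> K * exp (h * x)"
proof -
  define P where "P x = {g \<in> primitive_rays A. period g \<le> x}" for x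
  define E where "E x = exp (h * x) / (h * x)" for x :: real
  have P_eq: "P x = {g \<in> primitive_rays A. primitive_period A g \<le> x}" for x
    by (auto simp: P_def primitive_period_primitive)
  have E_pos: "E x > 0" if "x > 0" for x
    using that \<open>h > 0\<close> by (simp add: E_def)
  have "((\<lambda>x. real (card (P x)) / E x) \<longlongrightarrow> 1) at_top"
  proof (rule asymp_equivD_strong)
    show "(\<lambda>x. real (card (P x))) \<sim>[at_top] E"
      using asymp by (simp add: P_eq E_def[abs_def])
    show "\<forall>\<^sub>F x in at_top. real (card (P x)) \<noteq> 0 \<or> E x \<noteq> 0"
      using eventually_gt_at_top[of 0] by eventually_elim (use E_pos in force)
  qed
  then have "\<forall>\<^sub>F x in at_top. dist (real (card (P x)) / E x) 1 < 1/2"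
    by (rule tendstoD) simp
  then have bounds: "\<forall>\<^sub>F x in at_top. E x / 2 < real (card (P x)) \<and> real (card (P x)) < 2 * E x"
    using eventually_gt_at_top[of 0]
  proof eventually_elim
    case (elim x)
    have "1/2 < real (card (P x)) / E x" "real (card (P x)) / E x < 2"
      using elim(1) unfolding dist_real_def by linarith+
    then show ?case
      using E_pos[OF elim(2)] by (simp add: field_simps)
  qed
  with eventually_gt_at_top[of 0]
  have "\<forall>\<^sub>F x in at_top. x > 0 \<and> E x / 2 < real (card (P x))"
    by eventually_elim simp
  then obtain x0 where x0: "\<And>x. x \<ge> x0 \<Longrightarrow> x > 0 \<and> E x / 2 < real (card (P x))"
    unfolding eventually_at_top_linorder by blast
  have finP: "finite (P x)" for x
  proof (rule finite_subset)
    show "P x \<subseteq> P (max x x0)" by (auto simp: P_def)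
    have "card (P (max x x0)) > 0"
      using x0[of "max x x0"] E_pos[of "max x x0"] by simp
    then show "finite (P (max x x0))" by (rule card_ge_0_finite)
  qed
  have period_pos: "period g > 0" if "g \<in> primitive_rays A" for g
    using that by (auto simp: primitive_rays_def periodic_rays_def period_def)
  obtain t0 where t0: "t0 > 0" "\<And>g. g \<in> primitive_rays A \<Longrightarrow> t0 \<le> period g"
  proof
    let ?M = "Min (insert 1 (period ` P 1))"
    show "?M > 0"
      using finP[of 1] period_pos by (auto simp: P_def)
    fix g assume g: "g \<in> primitive_rays A"
    show "?M \<le> period g"
    proof (cases "period g \<le> 1")
      case True
      then show ?thesis using g finP[of 1] by (intro Min_le) (auto simp: P_def)
    next
      case False
      have "?M \<le> 1" using finP[of 1] by (intro Min_le) auto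
      with False show ?thesis by simp
    qed
  qed
  define R where "R x = (\<lambda>(g, n). real n * period g) ` (P x \<times> {1..nat \<lfloor>x / t0\<rfloor>})" for x
  have sub: "{l \<in> frequencies A. l \<le> x} \<subseteq> R x" for x
  proof
    fix l assume "l \<in> {l \<in> frequencies A. l \<le> x}"
    then obtain \<Gamma> where ray: "(\<Gamma>, l) \<in> periodic_rays A" "l \<le> x"
      by (auto simp: frequencies_def period_def)
    obtain T0 n where n: "(\<Gamma>, T0) \<in> primitive_rays A" "n \<ge> 1" "l = real n * T0"
      using periodic_ray_multiple[OF ray(1)] by metis
    have "t0 \<le> T0" using t0(2)[OF n(1)] by (simp add: period_def)
    have "1 * T0 \<le> real n * T0"
      using n(2) \<open>t0 \<le> T0\<close> t0(1) by (intro mult_right_mono) auto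
    then have "T0 \<le> x" using n(3) ray(2) by simp
    have "real n * t0 \<le> real n * T0"
      using \<open>t0 \<le> T0\<close> by (intro mult_left_mono) auto
    then have "real n \<le> x / t0"
      using n(3) ray(2) t0(1) by (simp add: field_simps)
    then have "n \<le> nat \<lfloor>x / t0\<rfloor>" by linarith
    then show "l \<in> R x"
      using n \<open>T0 \<le> x\<close> unfolding R_def
      by (intro image_eqI[of _ _ "((\<Gamma>, T0), n)"]) (auto simp: P_def period_def)
  qed
  have finR: "finite (R x)" for x
    using finP by (simp add: R_def)
  show fin: "finite {l \<in> frequencies A. l \<le> x}" for x
    using sub finR by (rule finite_subset)
  show "\<exists>l\<in>frequencies A. x < l"
  proof (rule ccontr)
    assume "\<not> (\<exists>l\<in>frequencies A. x < l)"
    then have const: "P y = P x" if "y \<ge> x" for y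
      using that by (force simp: P_def frequencies_def primitive_rays_def)
    have "LIM x at_top. E x / 2 :> at_top"
      unfolding E_def using \<open>h > 0\<close> by real_asymp
    then have "\<forall>\<^sub>F y in at_top. E y / 2 > real (card (P x))"
      by (simp add: filterlim_at_top_dense)
    then have "\<forall>\<^sub>F y::real in at_top. False"
      using bounds eventually_ge_at_top[of x]
    proof eventually_elim
      case (elim y)
      then show ?case using const[OF elim(3)] by simp
    qed
    then show False by simp
  qed
  show "\<exists>K>0. \<forall>\<^sub>F x in at_top. real (card {l \<in> frequencies A. l \<le> x}) \<le> K * exp (h * x)"
  proof (intro exI[of _ "2 / (h * t0)"] conjI)
    show "2 / (h * t0) > 0" using \<open>h > 0\<close> t0(1) by simp
    show "\<forall>\<^sub>F x in at_top. real (card {l \<in> frequencies A. l \<le> x}) \<le> 2 / (h * t0) * exp (h * x)"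
      using bounds eventually_gt_at_top[of 0]
    proof eventually_elim
      case (elim x)
      have "card {l \<in> frequencies A. l \<le> x} \<le> card (R x)"
        using sub finR by (intro card_mono)
      also have "\<dots> \<le> card (P x \<times> {1..nat \<lfloor>x / t0\<rfloor>})"
        unfolding R_def using finP by (intro card_image_le) auto
      finally have "real (card {l \<in> frequencies A. l \<le> x}) \<le> real (card (P x) * nat \<lfloor>x / t0\<rfloor>)"
        by (simp only: card_cartesian_product card_atLeastAtMost of_nat_le_iff) simp
      also have "\<dots> \<le> (2 * E x) * (x / t0)"
        unfolding of_nat_mult using elim t0(1) by (intro mult_mono) (auto simp: E_pos less_imp_le)
      also have "\<dots> = 2 / (h * t0) * exp (h * x)"
        using elim(2) \<open>h > 0\<close> t0(1) by (simp add: E_def field_simps)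
      finally show ?case .
    qed
  qed
qed

lemma ex1_ranked_element:
  fixes S :: "real set"
  assumes fin: "\<And>x. finite {l \<in> S. l \<le> x}" and unb: "\<And>x. \<exists>l\<in>S. x < l"
    and pos: "\<And>l. l \<in> S \<Longrightarrow> l > 0" and "n \<ge> 1"
  shows "\<exists>!l. l \<in> S \<and> card {l' \<in> S. l' \<le> l} = n"
proof (rule ex_ex1I)
  have succ: "\<exists>m\<in>S. card {l \<in> S. l \<le> m} = Suc (card {l \<in> S. l \<le> y})" for y
  proof -
    obtain z where z: "z \<in> S" "y < z" using unb by blast
    define F where "F = {l \<in> S. y < l \<and> l \<le> z}"
    have F: "finite F" "F \<noteq> {}"
      using z by (auto simp: F_def intro: finite_subset[OF _ fin[of z]])
    define m where "m = Min F"
    have "m \<in> F" unfolding m_def using F by (rule Min_in)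
    have "m \<le> l" if "l \<in> S" "y < l" for l
      using that Min_le[OF F(1), of l] \<open>m \<in> F\<close> unfolding m_def F_def by force
    then have "{l \<in> S. l \<le> m} = insert m {l \<in> S. l \<le> y}"
      using \<open>m \<in> F\<close> by (force simp: F_def)
    then show ?thesis
      using \<open>m \<in> F\<close> fin by (intro bexI[of _ m]) (auto simp: F_def)
  qed
  show "\<exists>l. l \<in> S \<and> card {l' \<in> S. l' \<le> l} = n"
    using \<open>n \<ge> 1\<close>
  proof (induction n rule: nat_induct_at_least)
    case base
    have "{l \<in> S. l \<le> 0} = {}" using pos by force
    with succ[of 0] show ?case by auto
  next
    case (Suc n)
    then show ?case using succ by metis
  qed
next
  fix l l' assume l: "l \<in> S \<and> card {x \<in> S. x \<le> l} = n" and l': "l' \<in> S \<and> card {x \<in> S. x \<le> l'} = n"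
  have "a = b" if "a \<in> S" "b \<in> S" "card {x \<in> S. x \<le> a} = card {x \<in> S. x \<le> b}" "a \<le> b" for a b
  proof -
    have "{x \<in> S. x \<le> a} = {x \<in> S. x \<le> b}"
      using that fin by (intro card_subset_eq) auto
    then have "b \<in> {x \<in> S. x \<le> a}" using that by simp
    with that show ?thesis by simp
  qed
  from this[of l l'] this[of l' l] l l' linorder_linear[of l l'] show "l = l'"
    by auto
qed

lemma frequency_rank:
  assumes "\<And>x. finite {l \<in> frequencies A. l \<le> x}" "\<And>x. \<exists>l\<in>frequencies A. x < l" "n \<ge> 1"
  shows "frequency A n \<in> frequencies A" and "card {l \<in> frequencies A. l \<le> frequency A n} = n"
proof -
  have "\<And>l. l \<in> frequencies A \<Longrightarrow> l > 0"
    by (auto simp: frequencies_def period_def periodic_rays_def)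
  from theI'[OF ex1_ranked_element[OF assms(1,2) this assms(3)]]
  show "frequency A n \<in> frequencies A" "card {l \<in> frequencies A. l \<le> frequency A n} = n"
    unfolding frequency_def by blast+
qed

lemma frequency_strict_mono:
  assumes "\<And>x. finite {l \<in> frequencies A. l \<le> x}" "\<And>x. \<exists>l\<in>frequencies A. x < l"
  shows "strict_mono_on {1..} (frequency A)"
proof (rule strict_mono_onI, rule ccontr)
  fix m n :: nat assume mn: "m \<in> {1..}" "n \<in> {1..}" "m < n" "\<not> frequency A m < frequency A n"
  then have "card {l \<in> frequencies A. l \<le> frequency A n} \<le> card {l \<in> frequencies A. l \<le> frequency A m}"
    using assms(1) by (intro card_mono) auto
  with mn frequency_rank(2)[OF assms, of m] frequency_rank(2)[OF assms, of n] show False by simp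
qed


section \<open>Convergence to the right of a point of convergence\<close>

lemma norm_exp_scale_diff_le:
  fixes s :: complex
  assumes "Re s < 0" "x \<le> y"
  shows "norm (exp (of_real y * s) - exp (of_real x * s))
    \<le> norm s / - Re s * (exp (Re s * x) - exp (Re s * y))"
proof (cases "x = y")
  case False
  define \<phi> where "\<phi> u = norm s / Re s * exp (Re s * u)" for u
  have "norm (exp (of_real y * s) - exp (of_real x * s)) \<le> \<phi> y - \<phi> x"
  proof (rule differentiable_bound_general)
    show "x < y" using False assms by simp
    show "continuous_on {x..y} \<phi>" unfolding \<phi>_def by (intro continuous_intros)
    show "continuous_on {x..y} (\<lambda>u. exp (of_real u * s))" by (intro continuous_intros)
    fix u
    show "((\<lambda>u. exp (complex_of_real u * s)) has_vector_derivative (s * exp (of_real u * s))) (at u)"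
      by (auto intro!: derivative_eq_intros has_vector_derivative_real_field)
    show "(\<phi> has_vector_derivative (norm s * exp (Re s * u))) (at u)"
      unfolding \<phi>_def has_real_derivative_iff_has_vector_derivative[symmetric]
      using assms by (auto intro!: derivative_eq_intros)
    show "norm (s * exp (of_real u * s)) \<le> norm s * exp (Re s * u)"
      by (simp add: norm_mult mult.commute)
  qed
  then show ?thesis using assms by (simp add: \<phi>_def field_simps)
qed simp

lemma summable_by_parts:
  fixes f g :: "nat \<Rightarrow> 'a::{banach, real_normed_algebra}"
  assumes f: "summable f" and g: "summable (\<lambda>n. norm (g (Suc n) - g n))"
  shows "summable (\<lambda>n. f n * g n)"
proof -
  define F where "F n = (\<Sum>i<n. f i)" for n
  have conv: "convergent F"
    using f by (simp add: F_def[abs_def] summable_iff_convergent)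
  have parts: "(\<Sum>n<N. f n * g n) = F N * g N - (\<Sum>n<N. F (Suc n) * (g (Suc n) - g n))" for N
    by (induction N) (auto simp: F_def algebra_simps)
  obtain B where B: "\<And>n. norm (F n) \<le> B"
    using convergent_imp_Bseq[OF conv] by (auto simp: Bseq_def)
  have "summable (\<lambda>n. F (Suc n) * (g (Suc n) - g n))"
  proof (rule summable_comparison_test')
    show "summable (\<lambda>n. B * norm (g (Suc n) - g n))" using g by (rule summable_mult)
    show "norm (F (Suc n) * (g (Suc n) - g n)) \<le> B * norm (g (Suc n) - g n)" for n
      using B[of "Suc n"] by (intro order_trans[OF norm_mult_ineq] mult_right_mono) auto
  qed
  moreover have "convergent g"
  proof -
    have "convergent (\<lambda>N. \<Sum>n<N. g (Suc n) - g n)"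
      using summable_norm_cancel[OF g] by (simp add: summable_iff_convergent)
    then have "convergent (\<lambda>N. (g N - g 0) + g 0)"
      by (intro convergent_add convergent_const) (simp add: sum_lessThan_telescope)
    then show ?thesis by simp
  qed
  ultimately show ?thesis
    unfolding summable_iff_convergent parts
    by (intro convergent_diff convergent_mult conv)
qed

lemma dirichlet_series_summable:
  fixes a lam :: "nat \<Rightarrow> real" and s :: complex
  assumes lam: "mono lam" and "Re s < 0"
    and sum: "summable (\<lambda>n. of_real (a n) * exp (- (of_real (lam n) * s)))"
  shows "summable a"
proof -
  define g where "g n = exp (of_real (lam n) * s)" for n
  define E where "E n = exp (Re s * lam n)" for n
  have "decseq E"
    using lam \<open>Re s < 0\<close> by (auto simp: E_def decseq_def mono_def intro: mult_left_mono_neg)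
  then obtain L where "E \<longlonglongrightarrow> L"
    by (rule decseq_convergent[of _ 0]) (auto simp: E_def)
  then have "summable (\<lambda>n. E n - E (Suc n))"
    by (rule telescope_summable')
  then have sumE: "summable (\<lambda>n. norm s / - Re s * (E n - E (Suc n)))"
    by (rule summable_mult)
  have "summable (\<lambda>n. norm (g (Suc n) - g n))"
    by (rule summable_comparison_test'[OF sumE])
      (use norm_exp_scale_diff_le[OF \<open>Re s < 0\<close>] lam in \<open>auto simp: g_def E_def mono_def\<close>)
  from summable_by_parts[OF sum this] have "summable (\<lambda>n. complex_of_real (a n))"
    by (simp add: g_def mult.assoc flip: exp_add)
  then show ?thesis by (simp add: summable_of_real_iff)
qed

lemma summable_eta_coeff:
  assumes "eta_abscissa A < 0" and mono: "strict_mono_on {1..} (frequency A)"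
  shows "summable (eta_coeff A)"
proof -
  obtain s where s: "Re s < 0" "summable (\<lambda>n. eta_term A s (Suc n))"
    using assms(1) by (auto simp: eta_abscissa_def Inf_less_iff)
  have "mono (\<lambda>n. frequency A (Suc n))"
    by (rule monoI) (use strict_mono_on_leD[OF mono] in auto)
  from dirichlet_series_summable[OF this s(1)] s(2)
  have "summable (\<lambda>n. eta_coeff A (Suc n))" by (simp add: eta_term_def)
  then show ?thesis by (simp only: summable_Suc_iff)
qed

lemma eta_tail_Suc:
  assumes "summable (eta_coeff A)"
  shows "eta_tail A m = eta_coeff A m + eta_tail A (Suc m)"
proof -
  have "summable (\<lambda>n. eta_coeff A (m + n))"
    using assms summable_iff_shift[of "eta_coeff A" m] by (simp add: add.commute)
  from suminf_split_head[OF this] show ?thesis by (simp add: eta_tail_def)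
qed


section \<open>Clusters\<close>

lemma cluster_right:
  assumes mono: "strict_mono_on {1..} lam" and "k \<ge> 1"
    and N: "\<And>n. n \<ge> 1 \<Longrightarrow> lam n \<le> b + 1 \<Longrightarrow> real n \<le> N"
    and small: "N * exp (- \<delta> * b) < exp (- b)" and "lam k \<le> b + 1 - exp (- b)"
  defines "q \<equiv> cluster_right lam \<delta> b k"
  shows "lam (k + q) < b + 1" and "lam (k + q + 1) - lam (k + q) \<ge> exp (- \<delta> * b)"
proof -
  define step where
    "step j \<longleftrightarrow> lam (k + j + 1) \<in> {lam (k + j)<..<lam (k + j) + exp (- \<delta> * b)}" for j
  have bound: "lam (k + j) \<le> lam k + real j * exp (- \<delta> * b) \<and> lam (k + j) < b + 1"
    if "\<And>i. i < j \<Longrightarrow> step i" for j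
    using that
  proof (induction j)
    case 0
    then show ?case using assms(5) exp_gt_zero[of "- b"] by (simp del: exp_gt_zero)
  next
    case (Suc j)
    then have IH: "lam (k + j) \<le> lam k + real j * exp (- \<delta> * b)" "lam (k + j) < b + 1"
      by auto
    have le: "lam (k + Suc j) \<le> lam k + real (Suc j) * exp (- \<delta> * b)"
      using IH(1) Suc.prems[of j] by (simp add: step_def algebra_simps)
    have "real (Suc j) \<le> real (k + j)" using \<open>k \<ge> 1\<close> by simp
    also have "\<dots> \<le> N"
      using IH(2) \<open>k \<ge> 1\<close> by (intro N) auto
    finally have "real (Suc j) * exp (- \<delta> * b) \<le> N * exp (- \<delta> * b)"
      by (intro mult_right_mono) auto
    with le small assms(5) have "lam (k + Suc j) < b + 1" by linarith
    with le show ?case by blast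
  qed
  have "\<exists>j. \<not> step j"
  proof (rule ccontr)
    assume "\<not> (\<exists>j. \<not> step j)"
    then have "real (k + j) \<le> N" for j
      using bound[of j] \<open>k \<ge> 1\<close> by (intro N) auto
    moreover obtain j where "N < real j" using reals_Archimedean2 by blast
    ultimately show False
      by (metis le_add2 of_nat_mono order_trans linorder_not_less)
  qed
  moreover have q: "q = (LEAST j. \<not> step j)"
    unfolding q_def cluster_right_def step_def ..
  ultimately have "\<not> step q" by (metis LeastI_ex)
  moreover have "lam (k + q) < lam (k + q + 1)"
    using \<open>k \<ge> 1\<close> by (intro strict_mono_onD[OF mono]) auto
  ultimately show "lam (k + q + 1) - lam (k + q) \<ge> exp (- \<delta> * b)"
    by (simp add: step_def)
  show "lam (k + q) < b + 1"
    using bound[of q] not_less_Least[of _ "\<lambda>j. \<not> step j"] q by blast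
qed

lemma cluster_left:
  assumes mono: "strict_mono_on {1..} lam" and "k \<ge> 1"
    and N: "\<And>n. n \<ge> 1 \<Longrightarrow> lam n \<le> b + 1 \<Longrightarrow> real n \<le> N"
    and small: "N * exp (- \<delta> * b) < exp (- b)"
    and "lam k \<in> {b + exp (- b)..b + 1}" and "lam 1 \<le> b"
  defines "p \<equiv> cluster_left lam \<delta> b k"
  shows "k \<ge> p + 2" and "b < lam (k - p)"
    and "lam (k - p) - lam (k - p - 1) \<ge> exp (- \<delta> * b)"
proof -
  define stop where "stop j \<longleftrightarrow> k \<le> j + 1 \<or>
        lam (k - j - 1) \<notin> {lam (k - j) - exp (- \<delta> * b)<..<lam (k - j)}" for j
  have p: "p = (LEAST j. stop j)"
    unfolding p_def cluster_left_def stop_def ..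
  have "stop k" by (simp add: stop_def)
  then have "stop p" unfolding p by (rule LeastI)
  have go: "\<not> stop j" if "j < p" for j
    using that not_less_Least[of _ stop] p by blast
  have "stop (k - 1)" using \<open>k \<ge> 1\<close> by (simp add: stop_def)
  with go[of "k - 1"] \<open>k \<ge> 1\<close> have "p < k" by linarith
  have "lam (k - j) \<ge> lam k - real j * exp (- \<delta> * b)" if "j \<le> p" for j
    using that
  proof (induction j)
    case (Suc j)
    with go[of j] show ?case by (simp add: stop_def algebra_simps)
  qed simp
  then have "lam (k - p) \<ge> lam k - real p * exp (- \<delta> * b)" by simp
  moreover have "real p * exp (- \<delta> * b) \<le> N * exp (- \<delta> * b)"
    using N[of k] \<open>k \<ge> 1\<close> \<open>p < k\<close> assms(5) by (intro mult_right_mono) auto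
  ultimately show "b < lam (k - p)"
    using small assms(5) unfolding atLeastAtMost_iff by linarith
  with assms(6) \<open>p < k\<close> have "k - p \<noteq> 1" by auto
  with \<open>p < k\<close> show "k \<ge> p + 2" by simp
  moreover have "lam (k - p - 1) < lam (k - p)"
    using \<open>k \<ge> p + 2\<close> by (intro strict_mono_onD[OF mono]) auto
  ultimately show "lam (k - p) - lam (k - p - 1) \<ge> exp (- \<delta> * b)"
    using \<open>stop p\<close> by (simp add: stop_def)
qed

theorem proposition4p1:
  fixes D :: "nat \<Rightarrow> (real ^ 'n) set" and A :: "(real ^ 'n) set" and r n0 :: nat
    and h \<delta> \<gamma> c1 c2 :: real
  assumes "CARD('n) \<ge> 2" and "r \<ge> 3" and "obstacles r D"
    and "A = (\<Union>j\<in>{1..r}. D j)"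
    and "h > 0"
    and "(\<lambda>x. real (card {g \<in> primitive_rays A. primitive_period A g \<le> x}))
           \<sim>[at_top] (\<lambda>x. exp (h * x) / (h * x))"
    and "eta_abscissa A < 0"
    and "\<delta> > h + 2"
    and "c1 > 0" and "c2 > 0"
    and "\<forall>n. 1 \<le> n \<and> n0 \<le> n \<longrightarrow> \<bar>eta_coeff A n\<bar> \<ge> c1 * exp (- c2 * frequency A n)"
    and "\<gamma> > c2 + 1"
  shows "\<exists>C>0. \<exists>b0. \<forall>b\<ge>b0. \<forall>k\<ge>1.
    frequency A k \<in> {b + exp (- b)..b + 1 - exp (- b)} \<longrightarrow>
    (let lam = frequency A;
         p = cluster_left lam \<delta> b k;
         q = cluster_right lam \<delta> b k;
         i = (\<bar>eta_tail A (k - p)\<bar> \<ge> exp (- \<gamma> * lam (k - p)));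
         ii = (\<bar>eta_tail A (k - p)\<bar> < exp (- \<gamma> * lam (k - p)));
         iii = (\<bar>eta_tail A (k + q)\<bar> \<ge> exp (- \<gamma> * lam (k + q)));
         iv = (\<bar>eta_tail A (k + q)\<bar> < exp (- \<gamma> * lam (k + q)))
     in {lam (k - p)..lam (k + q)} \<subseteq> {b<..<b + 1} \<and>
        (i \<or> ii) \<and> \<not> (i \<and> ii) \<and>
        (iii \<or> iv) \<and> \<not> (iii \<and> iv) \<and>
        (i \<or> (ii \<and> iv) \<longrightarrow>
           (\<exists>m\<in>{k - p, k + q + 1}. m \<ge> 2 \<and>
              lam m - lam (m - 1) \<ge> C * exp (- \<delta> * lam m) \<and>
              \<bar>eta_tail A m\<bar> \<ge> exp (- \<gamma> * lam m))))"
proof -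
  define lam where "lam = frequency A"
  define F where "F x = {l \<in> frequencies A. l \<le> x}" for x
  note growth = frequencies_growth[OF assms(5,6)]
  have rank: "card (F (lam n)) = n" if "n \<ge> 1" for n
    using frequency_rank(2)[OF growth(1,2) that] by (simp add: F_def lam_def)
  have mono: "strict_mono_on {1..} lam"
    using frequency_strict_mono[OF growth(1,2)] by (simp add: lam_def)
  have tail: "eta_tail A m = eta_coeff A m + eta_tail A (Suc m)" for m
    using mono assms(7) by (intro eta_tail_Suc summable_eta_coeff) (simp_all add: lam_def)
  obtain K where K: "K > 0" "\<forall>\<^sub>F x in at_top. real (card (F x)) \<le> K * exp (h * x)"
    using growth(3) unfolding F_def by blast
  have "filterlim (\<lambda>b::real. b + 1) at_top at_top" by real_asymp
  with K(2) have count: "\<forall>\<^sub>F b in at_top. real (card (F (b + 1))) \<le> K * exp (h * (b + 1))"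
    by (rule eventually_compose_filterlim)
  have "\<delta> - h - 1 > 0" using assms(8) by simp
  then have "((\<lambda>b. K * exp h * exp (- (\<delta> - h - 1) * b)) \<longlongrightarrow> 0) at_top"
    by real_asymp
  then have small: "\<forall>\<^sub>F b in at_top. K * exp h * exp (- (\<delta> - h - 1) * b) < 1"
    by (rule order_tendstoD) simp
  have "\<gamma> - c2 > 0" using assms(12) by simp
  then have "((\<lambda>b. 2 * exp (- (\<gamma> - c2) * b)) \<longlongrightarrow> 0) at_top"
    by real_asymp
  then have "\<forall>\<^sub>F b in at_top. 2 * exp (- (\<gamma> - c2) * b) < c1"
    using assms(9) by (rule order_tendstoD)
  with count small eventually_ge_at_top[of "lam 1"] eventually_ge_at_top[of "lam (Suc n0)"]
    eventually_ge_at_top[of 0]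
  have "\<forall>\<^sub>F b in at_top. \<forall>k\<ge>1. lam k \<in> {b + exp (- b)..b + 1 - exp (- b)} \<longrightarrow>
    (let p = cluster_left lam \<delta> b k; q = cluster_right lam \<delta> b k in
     b < lam (k - p) \<and> lam (k + q) < b + 1 \<and> k - p \<ge> 2 \<and>
     lam (k - p) - lam (k - p - 1) \<ge> exp (- \<delta> * lam (k - p)) \<and>
     lam (k + q + 1) - lam (k + q) \<ge> exp (- \<delta> * lam (k + q + 1)) \<and>
     (\<bar>eta_tail A (k + q)\<bar> < exp (- \<gamma> * lam (k + q)) \<longrightarrow>
      \<bar>eta_tail A (k + q + 1)\<bar> \<ge> exp (- \<gamma> * lam (k + q + 1))))"
  proof eventually_elim
    case (elim b)
    define N where "N = real (card (F (b + 1)))"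
    have N: "real n \<le> N" if "n \<ge> 1" "lam n \<le> b + 1" for n
    proof -
      have "card (F (lam n)) \<le> card (F (b + 1))"
        using that growth(1) by (intro card_mono) (auto simp: F_def)
      then show ?thesis using rank[OF that(1)] by (simp add: N_def)
    qed
    have "N * exp (- \<delta> * b) \<le> K * exp (h * (b + 1)) * exp (- \<delta> * b)"
      using elim(1) by (intro mult_right_mono) (auto simp: N_def)
    also have "\<dots> = (K * exp h * exp (- (\<delta> - h - 1) * b)) * exp (- b)"
      by (simp add: algebra_simps flip: exp_add)
    also have "\<dots> < 1 * exp (- b)"
      using elim(2) by (intro mult_strict_right_mono) auto
    finally have Nsmall: "N * exp (- \<delta> * b) < exp (- b)" by simp
    have "\<delta> > 0" "\<gamma> > 0" using assms by auto
    show ?case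
    proof (intro allI impI)
      fix k :: nat
      assume k: "k \<ge> 1" "lam k \<in> {b + exp (- b)..b + 1 - exp (- b)}"
      define p q where "p = cluster_left lam \<delta> b k" and "q = cluster_right lam \<delta> b k"
      have k_le: "lam k \<in> {b + exp (- b)..b + 1}" "lam k \<le> b + 1 - exp (- b)"
        using k(2) exp_gt_zero[of "- b"] unfolding atLeastAtMost_iff by linarith+
      have left: "k \<ge> p + 2" "b < lam (k - p)" "lam (k - p) - lam (k - p - 1) \<ge> exp (- \<delta> * b)"
        unfolding p_def by (rule cluster_left[OF mono k(1) _ Nsmall k_le(1) elim(3)], erule (1) N)+
      have right: "lam (k + q) < b + 1" "lam (k + q + 1) - lam (k + q) \<ge> exp (- \<delta> * b)"
        unfolding q_def by (rule cluster_right[OF mono k(1) _ Nsmall k_le(2)], erule (1) N)+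
      have exp_le: "exp (- \<delta> * x) \<le> exp (- \<delta> * b)" if "b < x" for x
        using that \<open>\<delta> > 0\<close> by simp
      have b_less: "b < lam (k + q)"
      proof -
        have "lam k \<le> lam (k + q)"
          using k(1) by (intro strict_mono_on_leD[OF mono]) auto
        with k(2) exp_gt_zero[of "- b"] show ?thesis
          unfolding atLeastAtMost_iff by linarith
      qed
      have less: "lam (k + q) < lam (k + q + 1)"
        using k(1) by (intro strict_mono_onD[OF mono]) auto
      have "n0 \<le> k + q"
      proof (rule ccontr)
        assume "\<not> n0 \<le> k + q"
        then have "lam (k + q) < lam (Suc n0)"
          using k(1) by (intro strict_mono_onD[OF mono]) auto
        with b_less elim(4) show False by simp
      qed
      then have coeff: "\<bar>eta_coeff A (k + q)\<bar> \<ge> c1 * exp (- c2 * lam (k + q))"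
        using assms(11) k(1) by (simp add: lam_def)
      have tail_right: "\<bar>eta_tail A (k + q + 1)\<bar> \<ge> exp (- \<gamma> * lam (k + q + 1))"
        if iv: "\<bar>eta_tail A (k + q)\<bar> < exp (- \<gamma> * lam (k + q))"
      proof -
        let ?l = "lam (k + q)"
        have "exp (- (\<gamma> - c2) * ?l) \<le> exp (- (\<gamma> - c2) * b)"
          using b_less \<open>\<gamma> - c2 > 0\<close> by simp
        then have "2 * exp (- (\<gamma> - c2) * ?l) \<le> c1" using elim(6) by linarith
        then have "2 * exp (- (\<gamma> - c2) * ?l) * exp (- c2 * ?l) \<le> c1 * exp (- c2 * ?l)"
          by (intro mult_right_mono) auto
        moreover have "exp (- (\<gamma> - c2) * ?l) * exp (- c2 * ?l) = exp (- \<gamma> * ?l)"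
          by (simp add: algebra_simps flip: exp_add)
        ultimately have "2 * exp (- \<gamma> * ?l) \<le> c1 * exp (- c2 * ?l)"
          by (simp only: mult.assoc)
        with iv coeff tail[of "k + q"] have "\<bar>eta_tail A (k + q + 1)\<bar> \<ge> exp (- \<gamma> * ?l)"
          by simp
        moreover have "exp (- \<gamma> * lam (k + q + 1)) \<le> exp (- \<gamma> * ?l)"
          using less \<open>\<gamma> > 0\<close> by simp
        ultimately show ?thesis by linarith
      qed
      show "let p = cluster_left lam \<delta> b k; q = cluster_right lam \<delta> b k in
        b < lam (k - p) \<and> lam (k + q) < b + 1 \<and> k - p \<ge> 2 \<and>
        lam (k - p) - lam (k - p - 1) \<ge> exp (- \<delta> * lam (k - p)) \<and>
        lam (k + q + 1) - lam (k + q) \<ge> exp (- \<delta> * lam (k + q + 1)) \<and>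
        (\<bar>eta_tail A (k + q)\<bar> < exp (- \<gamma> * lam (k + q)) \<longrightarrow>
         \<bar>eta_tail A (k + q + 1)\<bar> \<ge> exp (- \<gamma> * lam (k + q + 1)))"
        unfolding Let_def p_def[symmetric] q_def[symmetric]
      proof (intro conjI impI)
        show "b < lam (k - p)" by (rule left(2))
        show "lam (k + q) < b + 1" by (rule right(1))
        show "2 \<le> k - p" using left(1) by simp
        show "exp (- \<delta> * lam (k - p)) \<le> lam (k - p) - lam (k - p - 1)"
          using exp_le[OF left(2)] left(3) by (rule order_trans)
        have "b < lam (k + q + 1)" using b_less less by simp
        from exp_le[OF this] right(2)
        show "exp (- \<delta> * lam (k + q + 1)) \<le> lam (k + q + 1) - lam (k + q)"
          by (rule order_trans)
      qed (rule tail_right)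
    qed
  qed
  then obtain b0 where b0: "\<And>b k. b \<ge> b0 \<Longrightarrow> k \<ge> 1 \<Longrightarrow>
    lam k \<in> {b + exp (- b)..b + 1 - exp (- b)} \<Longrightarrow>
    (let p = cluster_left lam \<delta> b k; q = cluster_right lam \<delta> b k in
     b < lam (k - p) \<and> lam (k + q) < b + 1 \<and> k - p \<ge> 2 \<and>
     lam (k - p) - lam (k - p - 1) \<ge> exp (- \<delta> * lam (k - p)) \<and>
     lam (k + q + 1) - lam (k + q) \<ge> exp (- \<delta> * lam (k + q + 1)) \<and>
     (\<bar>eta_tail A (k + q)\<bar> < exp (- \<gamma> * lam (k + q)) \<longrightarrow>
      \<bar>eta_tail A (k + q + 1)\<bar> \<ge> exp (- \<gamma> * lam (k + q + 1))))"
    unfolding eventually_at_top_linorder by blast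
  show ?thesis
  proof (rule exI[of _ 1], rule conjI, simp, rule exI[of _ b0], intro allI impI)
    fix b and k :: nat
    assume hyps: "b \<ge> b0" "k \<ge> 1" "frequency A k \<in> {b + exp (- b)..b + 1 - exp (- b)}"
    show "let lam = frequency A;
         p = cluster_left lam \<delta> b k;
         q = cluster_right lam \<delta> b k;
         i = (\<bar>eta_tail A (k - p)\<bar> \<ge> exp (- \<gamma> * lam (k - p)));
         ii = (\<bar>eta_tail A (k - p)\<bar> < exp (- \<gamma> * lam (k - p)));
         iii = (\<bar>eta_tail A (k + q)\<bar> \<ge> exp (- \<gamma> * lam (k + q)));
         iv = (\<bar>eta_tail A (k + q)\<bar> < exp (- \<gamma> * lam (k + q)))
     in {lam (k - p)..lam (k + q)} \<subseteq> {b<..<b + 1} \<and>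
        (i \<or> ii) \<and> \<not> (i \<and> ii) \<and>
        (iii \<or> iv) \<and> \<not> (iii \<and> iv) \<and>
        (i \<or> (ii \<and> iv) \<longrightarrow>
           (\<exists>m\<in>{k - p, k + q + 1}. m \<ge> 2 \<and>
              lam m - lam (m - 1) \<ge> 1 * exp (- \<delta> * lam m) \<and>
              \<bar>eta_tail A m\<bar> \<ge> exp (- \<gamma> * lam m)))"
      using b0[OF hyps(1,2)] hyps(2,3) unfolding Let_def lam_def by auto
  qed
qed

end
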